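(* Let $G$ be a cubic (3-regular) $3$-connected graph not isomorphic to $K_4$. Then every spanning tree of $G$ contains at least $\frac{1}{3}|V(G)|-1$ many $3$-contractible edges. Moreover, this bound is sharp even when restricted to DFS trees: there exist cubic $3$-connected graphs $G\not\cong K_4$ admitting a DFS tree with exactly $\frac{1}{3}|V(G)|-1$ many $3$-contractible edges.
   Context: All graphs are finite, simple and undirected. A graph $G$ is $k$-connected if $|V(G)|>k$ and $G-T$ is connected for every $T\subseteq V(G)$ with $|T|<k$. For an edge $e$, $G/e$ denotes the graph obtained by identifying the two endvertices of $e$ and simplifying. An edge $e$ of a $3$-connected graph $G$ is $3$-contractible if $G/e$ is $3$-connected. A DFS tree of $G$ is a spanning tree $Q$ with a prescribed root $r$ such that for every vertex $x$, any two $x$-branches (vertex sets of components of $Q-x$ not containing $r$) are nonadjacent in $G$. *)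

theory Defs
  imports "Graph_Theory.Graph_Theory"
begin

text \<open>
  A finite simple undirected graph is a \<^locale>\<open>pair_graph\<close>: a finite loop-free digraph whose set of
  ordered pairs is symmetric. An undirected edge is thus a pair of opposite arcs, and edges have to
  be counted as unordered pairs.
\<close>

definition uedges :: "'a pair_pre_digraph \<Rightarrow> 'a set set" where
  "uedges G = (\<lambda>(u, v). {u, v}) ` parcs G"

definition cubic :: "'a pair_pre_digraph \<Rightarrow> bool" where
  "cubic G \<longleftrightarrow> (\<forall>v\<in>pverts G. out_degree (with_proj G) v = 3)"

definition k_connected :: "nat \<Rightarrow> 'a pair_pre_digraph \<Rightarrow> bool" where
  "k_connected k G \<longleftrightarrow> k < card (pverts G) \<and>
     (\<forall>T. T \<subseteq> pverts G \<and> card T < k \<longrightarrow> connected (with_proj G \<restriction> (pverts G - T)))"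

text \<open>
  The vertices of \<open>G/e\<close> are the classes of the identification: the new vertex is \<open>e\<close> itself, and
  every other vertex \<open>x\<close> becomes \<open>{x}\<close>. Excluding equal classes removes the loop; parallel edges
  merge because the arcs form a set of pairs.
\<close>

definition contract_class :: "'a set \<Rightarrow> 'a \<Rightarrow> 'a set" where
  "contract_class e x = (if x \<in> e then e else {x})"

definition contract_edge :: "'a pair_pre_digraph \<Rightarrow> 'a set \<Rightarrow> 'a set pair_pre_digraph" where
  "contract_edge G e =
     \<lparr> pverts = contract_class e ` pverts G,
       parcs = {(contract_class e u, contract_class e v) | u v.
                  (u, v) \<in> parcs G \<and> contract_class e u \<noteq> contract_class e v} \<rparr>"

definition three_contractible :: "'a pair_pre_digraph \<Rightarrow> 'a set \<Rightarrow> bool" where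
  "three_contractible G e \<longleftrightarrow> e \<in> uedges G \<and> k_connected 3 (contract_edge G e)"

text \<open>
  The library's \<^const>\<open>tree\<close> only excludes directed cycles: it is false for a symmetric digraph with an
  arc (two opposite arcs are a cycle) and true for an acyclic orientation of an undirected cycle.
  In a \<^locale>\<open>pair_graph\<close> the undirected cycles are exactly the directed cycles of length at least 3.
\<close>

definition spanning_utree :: "'a pair_pre_digraph \<Rightarrow> 'a pair_pre_digraph \<Rightarrow> bool" where
  "spanning_utree Q G \<longleftrightarrow> pair_graph Q \<and> spanning (with_proj Q) (with_proj G) \<and>
     connected (with_proj Q) \<and>
     \<not> (\<exists>p. pre_digraph.cycle (with_proj Q) p \<and> 3 \<le> length p)"

text \<open>
  The strongly connected components of a symmetric digraph are the components of the
  undirected graph.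
\<close>

definition branches :: "'a pair_pre_digraph \<Rightarrow> 'a \<Rightarrow> 'a \<Rightarrow> 'a set set" where
  "branches Q r x =
     {B \<in> pre_digraph.sccs_verts (pre_digraph.del_vert (with_proj Q) x). r \<notin> B}"

definition dfs_tree :: "'a pair_pre_digraph \<Rightarrow> 'a pair_pre_digraph \<Rightarrow> 'a \<Rightarrow> bool" where
  "dfs_tree Q G r \<longleftrightarrow> spanning_utree Q G \<and> r \<in> pverts G \<and>
     (\<forall>x\<in>pverts G. \<forall>B\<in>branches Q r x. \<forall>C\<in>branches Q r x.
        B \<noteq> C \<longrightarrow> \<not> (\<exists>b\<in>B. \<exists>c\<in>C. (b, c) \<in> parcs G))"

end

theory Submission
  imports Defs
begin

text \<open>
  An edge \<open>uv\<close> is non-contractible iff \<open>u\<close>, \<open>v\<close> and some third vertex separate \<open>G\<close>. If two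
  edges \<open>uv\<close>, \<open>ux\<close> are non-contractible, then, as \<open>u\<close> has degree 3, comparing the two separators
  shows that \<open>uv\<close> lies in a triangle. Since edges of triangles are non-contractible and triangles of
  \<open>G\<close> are disjoint, being equal or joined by a non-contractible edge is an equivalence relation on
  the vertices, with classes of size at most 3. A tree has at most \<open>2/3 |K|\<close> edges inside a class
  \<open>K\<close>, so at most \<open>2/3 |V|\<close> of its \<open>|V| - 1\<close> edges are non-contractible.

  Equality holds if the triangles partition the vertex set and the tree contains two edges of each
  triangle. Truncated Moebius ladders have a Hamiltonian path with this property, and a
  Hamiltonian path rooted at one of its ends is a DFS tree.
\<close>

section \<open>Cut criterion for connectedness\<close>

lemma (in wf_digraph) connected_iff_cut:
  "connected G \<longleftrightarrow> verts G \<noteq> {} \<and>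
     (\<forall>X. X \<noteq> {} \<and> X \<subset> verts G \<longrightarrow> (\<exists>x\<in>X. \<exists>y\<in>verts G - X. (x, y) \<in> (arcs_ends G)\<^sup>s))"
  (is "_ \<longleftrightarrow> _ \<and> ?cut")
proof
  assume L: "connected G"
  have "?cut"
  proof (intro allI impI)
    fix X assume X: "X \<noteq> {} \<and> X \<subset> verts G"
    then obtain a b where "a \<in> X" "b \<in> verts G - X" by blast
    have "(a, b) \<in> rtrancl_on (verts G) ((arcs_ends G)\<^sup>s)"
      using L \<open>a \<in> X\<close> \<open>b \<in> verts G - X\<close> X by (auto simp: connected_conv)
    then have "b \<in> X \<or> (\<exists>x\<in>X. \<exists>y\<in>verts G - X. (x, y) \<in> (arcs_ends G)\<^sup>s)"
      by (induction rule: rtrancl_on_induct) (use \<open>a \<in> X\<close> in blast)+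
    then show "\<exists>x\<in>X. \<exists>y\<in>verts G - X. (x, y) \<in> (arcs_ends G)\<^sup>s"
      using \<open>b \<in> verts G - X\<close> by blast
  qed
  then show "verts G \<noteq> {} \<and> ?cut" using L by (auto simp: connected_conv)
next
  assume R: "verts G \<noteq> {} \<and> ?cut"
  have "(u, v) \<in> rtrancl_on (verts G) ((arcs_ends G)\<^sup>s)" if "u \<in> verts G" "v \<in> verts G" for u v
  proof (rule ccontr)
    assume nr: "\<not> ?thesis"
    \<comment> \<open>The set reachable from \<open>u\<close> is closed under adjacency, so the cut
      condition fails for it as soon as it misses \<open>v\<close>.\<close>
    let ?X = "{w \<in> verts G. (u, w) \<in> rtrancl_on (verts G) ((arcs_ends G)\<^sup>s)}"
    have "?X \<noteq> {} \<and> ?X \<subset> verts G" using that nr by auto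
    then obtain x y where xy: "x \<in> ?X" "y \<in> verts G - ?X" "(x, y) \<in> (arcs_ends G)\<^sup>s"
      using R by meson
    then have "(u, y) \<in> rtrancl_on (verts G) ((arcs_ends G)\<^sup>s)"
      by (blast intro: rtrancl_on_into_rtrancl_on[of u x])
    then show False using xy by simp
  qed
  then show "connected G" using R by (auto simp: connected_conv)
qed


subsection \<open>Separations and contractions\<close>

text \<open>In an undirected graph \<open>A\<close> and \<open>B\<close> may each be a union of
  several components of \<open>G - T\<close>. Unlike a bare separator, the triple can be pulled back
  along a contraction and altered by moving single vertices.\<close>

definition separation :: "'a pair_pre_digraph \<Rightarrow> 'a set \<Rightarrow> 'a set \<Rightarrow> 'a set \<Rightarrow> bool" where
  "separation G T A B \<longleftrightarrow> T \<union> A \<union> B = pverts G \<and> T \<inter> A = {} \<and> T \<inter> B = {} \<and> A \<inter> B = {} \<and>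
     A \<noteq> {} \<and> B \<noteq> {} \<and> (\<forall>a\<in>A. \<forall>b\<in>B. (a, b) \<notin> parcs G)"

lemma (in pair_graph) arc_sym: "(u, v) \<in> parcs G \<Longrightarrow> (v, u) \<in> parcs G"
  using sym_arcs by (auto simp: symmetric_def dest: symD)

lemma (in pair_graph) connected_induce_iff:
  "connected (with_proj G \<restriction> S) \<longleftrightarrow> S \<noteq> {} \<and>
     (\<forall>X. X \<noteq> {} \<and> X \<subset> S \<longrightarrow> (\<exists>x\<in>X. \<exists>y\<in>S - X. (x, y) \<in> parcs G))"
proof -
  interpret S: wf_digraph "with_proj G \<restriction> S" by (rule wellformed_induce_subgraph)
  have eq: "(arcs_ends (with_proj G \<restriction> S))\<^sup>s = {(x, y) \<in> parcs G. x \<in> S \<and> y \<in> S}"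
    by (auto simp: symcl_def arcs_ends_conv image_iff intro: arc_sym)
  have "(\<exists>x\<in>X. \<exists>y\<in>S - X. (x, y) \<in> (arcs_ends (with_proj G \<restriction> S))\<^sup>s) \<longleftrightarrow>
      (\<exists>x\<in>X. \<exists>y\<in>S - X. (x, y) \<in> parcs G)" if "X \<subset> S" for X
    using that unfolding eq by blast
  then show ?thesis unfolding S.connected_iff_cut by (simp cong: conj_cong imp_cong)
qed

lemma (in pair_graph) separation_commute: "separation G T A B \<longleftrightarrow> separation G T B A"
  by (auto simp: separation_def dest: arc_sym)

lemma (in pair_graph) k_connected_iff_separation:
  "k_connected k G \<longleftrightarrow> k < card (pverts G) \<and> (\<forall>T A B. separation G T A B \<longrightarrow> k \<le> card T)"
proof (intro iffI conjI allI impI)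
  assume k: "k_connected k G"
  then show "k < card (pverts G)" by (simp add: k_connected_def)
  fix T A B assume s: "separation G T A B"
  then have T: "T \<subseteq> pverts G" "pverts G - T = A \<union> B" by (auto simp: separation_def)
  show "k \<le> card T"
  proof (rule ccontr)
    assume "\<not> k \<le> card T"
    then have "connected (with_proj G \<restriction> (A \<union> B))"
      using k T by (auto simp: k_connected_def simp flip: T(2))
    moreover have "A \<noteq> {} \<and> A \<subset> A \<union> B" "A \<union> B - A = B" using s by (auto simp: separation_def)
    ultimately have "\<exists>x\<in>A. \<exists>y\<in>B. (x, y) \<in> parcs G"
      unfolding connected_induce_iff by metis
    then show False using s by (auto simp: separation_def)
  qed
next
  assume R: "k < card (pverts G) \<and> (\<forall>T A B. separation G T A B \<longrightarrow> k \<le> card T)"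
  show "k_connected k G" unfolding k_connected_def
  proof (intro conjI allI impI)
    fix T assume T: "T \<subseteq> pverts G \<and> card T < k"
    show "connected (with_proj G \<restriction> (pverts G - T))"
      unfolding connected_induce_iff
    proof (intro conjI allI impI)
      have "T \<noteq> pverts G" using T R by auto
      then show "pverts G - T \<noteq> {}" using T by auto
    next
      fix X assume X: "X \<noteq> {} \<and> X \<subset> pverts G - T"
      have "\<not> separation G T X (pverts G - T - X)" using R T not_le by blast
      then show "\<exists>x\<in>X. \<exists>y\<in>pverts G - T - X. (x, y) \<in> parcs G"
        using X T by (auto simp: separation_def)
    qed
  qed (use R in simp)
qed

text \<open>\<open>S - X\<close> separates \<open>X\<close> from the remaining vertices, among them
  \<open>z\<close>. Most contradictions below come from a set whose boundary has only two
  vertices.\<close>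

lemma (in pair_graph) k_connected_boundary:
  assumes "k_connected k G" "X \<subseteq> pverts G" "X \<noteq> {}" "S \<subseteq> pverts G"
    and "\<And>x y. (x, y) \<in> parcs G \<Longrightarrow> x \<in> X \<Longrightarrow> y \<in> X \<union> S"
    and "z \<in> pverts G" "z \<notin> X" "z \<notin> S"
  shows "k \<le> card S"
proof -
  have "k \<le> card (S - X)"
  proof -
    have "separation G (S - X) X (pverts G - X - S)"
      using assms by (auto simp: separation_def)
    then show ?thesis using assms(1) by (auto simp: k_connected_iff_separation)
  qed
  also have "\<dots> \<le> card S"
    using finite_subset[OF assms(4)] finite_verts by (intro card_mono) auto
  finally show ?thesis .
qed

text \<open>If \<open>t\<close> had no neighbour in \<open>A\<close>, moving it to \<open>B\<close>
  would leave a separation with separator \<open>T - {t}\<close>, which has fewer than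
  \<open>k\<close> vertices.\<close>

lemma (in pair_graph) k_connected_separation_neighbour:
  assumes "k_connected k G" "separation G T A B" "card T \<le> k" "t \<in> T"
  shows "\<exists>a\<in>A. (t, a) \<in> parcs G"
proof (rule ccontr)
  assume "\<not> ?thesis"
  then have "separation G (T - {t}) A (insert t B)"
    using assms by (auto simp: separation_def dest: arc_sym)
  then have "k \<le> card (T - {t})" using assms(1) by (auto simp: k_connected_iff_separation)
  moreover have "finite T" 
    using assms(2) finite_verts by (auto simp: separation_def intro: finite_subset)
  ultimately show False using assms(3,4) card_Diff1_less[of T t] by linarith
qed

lemma (in pair_graph) pair_graph_contract_edge: "pair_graph (contract_edge G e)"
proof
  have "parcs (contract_edge G e) \<subseteq>
      (\<lambda>(u, v). (contract_class e u, contract_class e v)) ` parcs G"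
    by (auto simp: contract_edge_def)
  then show "finite (parcs (contract_edge G e))"
    using pair_finite_arcs by (rule finite_subset[OF _ finite_imageI])
  show "symmetric (with_proj (contract_edge G e))"
    by (auto simp: symmetric_def contract_edge_def intro!: symI dest: arc_sym)
qed (use finite_verts in \<open>auto simp: contract_edge_def dest: in_arcsD1 in_arcsD2\<close>)

lemma inj_on_contract_class: "inj_on (contract_class e) (- e)"
  by (auto simp: inj_on_def contract_class_def)

text \<open>A separator of \<open>G/e\<close> with at most two vertices lifts to \<open>G\<close> by
  taking preimages. The lifted separator has at least three vertices, which forces it to consist of
  both ends of \<open>e\<close> and exactly one more vertex.\<close>

lemma (in pair_graph) non_contractible_separation:
  assumes "k_connected 3 G" "4 < card (pverts G)" "(u, v) \<in> parcs G"
    and "\<not> three_contractible G {u, v}"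
  shows "\<exists>w A B. w \<noteq> u \<and> w \<noteq> v \<and> separation G {u, v, w} A B"
proof -
  let ?e = "{u, v}" and ?c = "contract_class {u, v}"
  let ?H = "contract_edge G ?e"
  interpret H: pair_graph ?H by (rule pair_graph_contract_edge)
  have uv: "u \<in> pverts G" "v \<in> pverts G" "u \<noteq> v"
    using assms(3) by (auto dest: in_arcsD1 in_arcsD2 no_loops)
  have "pverts ?H = insert ?e ((\<lambda>x. {x}) ` (pverts G - ?e))"
    using uv by (auto simp: contract_edge_def contract_class_def)
  moreover have "?e \<notin> (\<lambda>x. {x}) ` (pverts G - ?e)" using uv by auto
  moreover have "card ((\<lambda>x. {x}) ` (pverts G - ?e)) = card (pverts G) - 2"
    using uv by (subst card_image) (auto simp: card_Diff_subset)
  ultimately have "card (pverts ?H) = Suc (card (pverts G) - 2)"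
    using finite_verts by simp
  \<comment> \<open>Contraction costs one vertex, so \<open>G/e\<close> cannot fail by its size and
    must have a small separator.\<close>
  then have "3 < card (pverts ?H)" using assms(2) by linarith
  moreover have "\<not> k_connected 3 ?H"
    using assms(3,4) by (force simp: three_contractible_def uedges_def)
  ultimately obtain T A B where s: "separation ?H T A B" "card T < 3"
    by (auto simp: H.k_connected_iff_separation not_le)
  have fT: "finite T" using s(1) H.finite_verts by (auto simp: separation_def intro: finite_subset)
  define pre where "pre Z = {x \<in> pverts G. ?c x \<in> Z}" for Z
  have part: "?c x \<in> T \<union> A \<union> B" if "x \<in> pverts G" for x
    using s(1) that by (auto simp: separation_def contract_edge_def)
  have ne: "pre Z \<noteq> {}" if "Z \<noteq> {}" "Z \<subseteq> pverts ?H" for Z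
    using that by (auto simp: pre_def contract_edge_def)
  have sG: "separation G (pre T) (pre A) (pre B)"
    unfolding separation_def
  proof (intro conjI ballI)
    show "pre A \<noteq> {}" using s(1) by (intro ne) (auto simp: separation_def)
    show "pre B \<noteq> {}" using s(1) by (intro ne) (auto simp: separation_def)
    show "pre T \<union> pre A \<union> pre B = pverts G" using part by (auto simp: pre_def)
    fix a b assume "a \<in> pre A" "b \<in> pre B"
    then have *: "?c a \<in> A" "?c b \<in> B" by (auto simp: pre_def)
    then have "?c a \<noteq> ?c b" "(?c a, ?c b) \<notin> parcs ?H" using s(1) by (auto simp: separation_def)
    then show "(a, b) \<notin> parcs G" by (auto simp: contract_edge_def)
  qed (use s(1) in \<open>auto simp: separation_def pre_def\<close>)
  then have 3: "3 \<le> card (pre T)" using assms(1) by (auto simp: k_connected_iff_separation)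
  have bound: "card (pre T - ?e) \<le> card (T - {?e})"
  proof (rule card_inj_on_le)
    show "inj_on ?c (pre T - ?e)" by (rule inj_on_subset[OF inj_on_contract_class]) auto
    show "?c ` (pre T - ?e) \<subseteq> T - {?e}" by (auto simp: pre_def contract_class_def)
  qed (use fT in simp)
  \<comment> \<open>Otherwise the preimage of \<open>T\<close> would have no more vertices than
    \<open>T\<close>, hence at most two.\<close>
  have "?e \<in> T"
  proof (rule ccontr)
    assume "?e \<notin> T"
    then have "pre T - ?e = pre T" by (auto simp: pre_def contract_class_def)
    then show False using bound 3 s(2) \<open>?e \<notin> T\<close> by simp
  qed
  then have "?e \<subseteq> pre T" using uv by (auto simp: pre_def contract_class_def)
  then have "card (pre T - ?e) = card (pre T) - 2" using uv by (simp add: card_Diff_subset)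
  moreover have "card (T - {?e}) \<le> 1" using \<open>?e \<in> T\<close> s(2) fT by simp
  ultimately have "card (pre T - ?e) = 1" using bound 3 by linarith
  then obtain w where w: "pre T - ?e = {w}" by (auto simp: card_1_singleton_iff)
  then have "pre T = {u, v, w}" using \<open>?e \<subseteq> pre T\<close> by auto
  then have "separation G {u, v, w} (pre A) (pre B)" using sG by simp
  moreover have "w \<notin> ?e" using w by blast
  ultimately show ?thesis by blast
qed

subsection \<open>Non-contractible edges of cubic graphs\<close>

lemma (in pair_graph) three_connected_separation_neighbours:
  assumes "k_connected 3 G" "separation G {x, y, z} A B" "t \<in> {x, y, z}"
  shows "\<exists>a\<in>A. (t, a) \<in> parcs G" "\<exists>b\<in>B. (t, b) \<in> parcs G"
proof -
  have "card {x, y, z} \<le> 3" by (simp add: card_insert_if)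
  then show "\<exists>a\<in>A. (t, a) \<in> parcs G" "\<exists>b\<in>B. (t, b) \<in> parcs G"
    using assms k_connected_separation_neighbour separation_commute by blast+
qed

lemma (in pair_graph) separation_arc:
  assumes "separation G T A B" "(x, y) \<in> parcs G" "x \<in> A"
  shows "y \<in> A \<union> T"
  using assms in_arcsD2[OF assms(2)] unfolding separation_def by blast

text \<open>The two separations cut the graph into corners. The corner \<open>B \<inter> D\<close>
  contains \<open>b\<close> and forces \<open>w'\<close> into \<open>B\<close> and \<open>w\<close>
  into \<open>D\<close>. The opposite corner \<open>A \<inter> C\<close> is then bounded by
  \<open>v\<close> and \<open>a\<close> alone, so it is empty, and \<open>a\<close> can reach
  \<open>C\<close> only through \<open>v\<close>.\<close>

lemma (in pair_graph) crossing_separations_triangle: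
  assumes conn: "k_connected 3 G"
    and sep: "separation G {u, v, w} A B" "separation G {u, a, w'} C D"
    and arcs: "(u, v) \<in> parcs G" "\<And>y. (u, y) \<in> parcs G \<Longrightarrow> y \<in> {v, a, b}"
    and "w \<noteq> v" "a \<in> A" "b \<in> B" "v \<in> C" "b \<in> D"
  shows "(a, v) \<in> parcs G"
proof -
  have "u \<noteq> v" using arcs(1) by (auto dest: no_loops)
  have V: "{u, v, w} \<union> A \<union> B = pverts G" "{u, a, w'} \<union> C \<union> D = pverts G"
    using sep by (auto simp: separation_def)
  have ndisj: "u \<notin> A" "u \<notin> B" "v \<notin> A" "v \<notin> B" "w \<notin> A" "w \<notin> B"
      "u \<notin> C" "u \<notin> D" "a \<notin> C" "a \<notin> D" "w' \<notin> C" "w' \<notin> D" "A \<inter> B = {}" "C \<inter> D = {}"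
    using sep by (auto simp: separation_def)
  note nbr = separation_arc[OF sep(1)] and nbrC = separation_arc[OF sep(2)]
  note nbr' = separation_arc[OF sep(1)[THEN separation_commute[THEN iffD1]]]
    and nbrD = separation_arc[OF sep(2)[THEN separation_commute[THEN iffD1]]]
  have a: "a \<notin> B" "a \<noteq> u" "a \<noteq> v" "a \<noteq> w" "b \<noteq> u" "b \<noteq> v" "b \<noteq> a" "v \<notin> D" "w' \<noteq> v"
    using assms(7-) ndisj by auto
  \<comment> \<open>Otherwise \<open>B \<inter> D\<close>, which contains \<open>b\<close>, is separated by \<open>u\<close> and only one of \<open>w\<close>, \<open>w'\<close>.\<close>
  have "w' \<in> B \<and> w \<in> D"
  proof (rule ccontr)
    assume "\<not> (w' \<in> B \<and> w \<in> D)"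
    then consider "w' \<notin> B" | "w \<notin> D" by blast
    then obtain s where s: "s = w \<or> s = w'"
      and "\<And>x y. (x, y) \<in> parcs G \<Longrightarrow> x \<in> D \<inter> B \<Longrightarrow> y \<in> D \<inter> B \<union> {u, s}"
    proof cases
      case 1
      have "y \<in> D \<inter> B \<union> {u, w}" if "(x, y) \<in> parcs G" "x \<in> D \<inter> B" for x y
        using nbr'[OF that(1)] nbrD[OF that(1)] that(2) 1 a assms(6-) by blast
      then show ?thesis using that by blast
    next
      case 2
      have "y \<in> D \<inter> B \<union> {u, w'}" if "(x, y) \<in> parcs G" "x \<in> D \<inter> B" for x y
        using nbr'[OF that(1)] nbrD[OF that(1)] that(2) 2 a assms(6-) by blast
      then show ?thesis using that by blast
    qed
    then have "3 \<le> card {u, s}"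
      using V assms(6-) a ndisj \<open>u \<noteq> v\<close>
      by (intro k_connected_boundary[OF conn, of "D \<inter> B" _ v]) blast+
    moreover have "card {u, s} \<le> 2" by (simp add: card_insert_if)
    ultimately show False by linarith
  qed
  \<comment> \<open>Hence \<open>w\<close> and \<open>w'\<close> are not adjacent to \<open>A \<inter> C\<close>, and neither is \<open>u\<close>.\<close>
  have "C \<inter> A = {}"
  proof (rule ccontr)
    assume "C \<inter> A \<noteq> {}"
    moreover have "y \<in> C \<inter> A \<union> {v, a}" if xy: "(x, y) \<in> parcs G" "x \<in> C \<inter> A" for x y
    proof -
      have "y \<noteq> u" using arcs(2)[OF arc_sym, of x] xy a assms(6-) ndisj by blast
      then show ?thesis
        using nbr[OF xy(1)] nbrC[OF xy(1)] xy(2) \<open>w' \<in> B \<and> w \<in> D\<close> ndisj by blast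
    qed
    ultimately have "3 \<le> card {v, a}"
      using V(1) assms(6-) a ndisj
      by (intro k_connected_boundary[OF conn, of "C \<inter> A" "{v, a}" b]) auto
    then show False using a by simp
  qed
  \<comment> \<open>This neighbour lies in \<open>A \<union> {u, v, w}\<close>. As
    \<open>C \<inter> A\<close> is empty, \<open>u\<close> is in the second separator and
    \<open>w\<close> is in \<open>D\<close>, only \<open>v\<close> remains.\<close>
  obtain c where "c \<in> C" "(a, c) \<in> parcs G"
    using three_connected_separation_neighbours(1)[OF conn sep(2), of a] by auto
  moreover have "c \<in> A \<union> {u, v, w}" using nbr \<open>(a, c) \<in> parcs G\<close> \<open>a \<in> A\<close> by blast
  moreover have "c \<noteq> u" "c \<noteq> w" "c \<notin> A"
    using \<open>c \<in> C\<close> \<open>C \<inter> A = {}\<close> \<open>w' \<in> B \<and> w \<in> D\<close> ndisj by blast+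
  ultimately have "c = v" by blast
  then show ?thesis using \<open>(a, c) \<in> parcs G\<close> by simp
qed

section \<open>Triangles and adjacent non-contractible edges\<close>

locale cubic_three_connected_graph = pair_graph G for G :: "'a pair_pre_digraph" +
  assumes cubic: "cubic G" and three_connected: "k_connected 3 G" and not_K4: "\<not> K\<^bsub>4\<^esub> (with_proj G)"
begin

lemma card_neighbours: "v \<in> pverts G \<Longrightarrow> card {w. (v, w) \<in> parcs G} = 3"
proof -
  assume "v \<in> pverts G"
  then have "card (out_arcs (with_proj G) v) = 3" using cubic by (simp add: cubic_def out_degree_def)
  moreover have "out_arcs (with_proj G) v = Pair v ` {w. (v, w) \<in> parcs G}"
    by (auto simp: out_arcs_def)
  ultimately show ?thesis by (simp add: card_image inj_on_def)
qed

lemma neighbour_cases: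
  assumes "(p, q) \<in> parcs G" "(p, r) \<in> parcs G" "(p, s) \<in> parcs G" "q \<noteq> r" "q \<noteq> s" "r \<noteq> s"
    and "(p, x) \<in> parcs G"
  shows "x = q \<or> x = r \<or> x = s"
proof -
  have "card {w. (p, w) \<in> parcs G} = 3" using assms(1) by (intro card_neighbours in_arcsD1)
  moreover from this have "finite {w. (p, w) \<in> parcs G}" by (intro card_ge_0_finite) simp
  ultimately have "{q, r, s} = {w. (p, w) \<in> parcs G}"
    using assms by (intro card_subset_eq) auto
  then show ?thesis using assms(7) by blast
qed

text \<open>3-connectedness gives at least four vertices, and a cubic graph on exactly four vertices
  is K4.\<close>

lemma four_less_card: "4 < card (pverts G)"
proof (rule ccontr)
  assume "\<not> ?thesis"
  moreover have "3 < card (pverts G)" using three_connected by (simp add: k_connected_def)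
  ultimately have 4: "card (pverts G) = 4" by linarith
  have "{w. (v, w) \<in> parcs G} = pverts G - {v}" if "v \<in> pverts G" for v
    using that 4 finite_verts card_neighbours[OF that]
    by (intro card_subset_eq) (auto dest: in_arcsD2 no_loops)
  then have "parcs G = {(u, v). (u, v) \<in> pverts G \<times> pverts G \<and> u \<noteq> v}"
    using in_arcsD1 by blast
  then show False using not_K4 4 finite_verts by (simp add: complete_digraph_pair_def)
qed

text \<open>Supplies the far vertex \<open>z\<close> for \<open>k_connected_boundary\<close> when
  the set and its boundary involve at most four vertices.\<close>

lemma ex_vert_avoiding:
  obtains z where "z \<in> pverts G" "z \<noteq> a" "z \<noteq> b" "z \<noteq> c" "z \<noteq> d"
proof -
  have "\<not> pverts G \<subseteq> {a, b, c, d}"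
  proof
    assume "pverts G \<subseteq> {a, b, c, d}"
    then have "card (pverts G) \<le> card {a, b, c, d}" by (intro card_mono) auto
    also have "\<dots> \<le> 4" by (simp add: card_insert_if)
    finally show False using four_less_card by simp
  qed
  then show ?thesis using that by blast
qed

text \<open>With two triangles on the edge \<open>uv\<close>, all further neighbours of
  \<open>u\<close> and \<open>v\<close> are \<open>x\<close> and \<open>y\<close>, so these two
  vertices would separate the graph.\<close>

lemma triangle_unique:
  assumes "(u, v) \<in> parcs G" "(u, x) \<in> parcs G" "(v, x) \<in> parcs G" "(u, y) \<in> parcs G" "(v, y) \<in> parcs G"
  shows "x = y"
proof (rule ccontr)
  assume "x \<noteq> y"
  obtain z where z: "z \<in> pverts G" "z \<noteq> u" "z \<noteq> v" "z \<noteq> x" "z \<noteq> y" by (rule ex_vert_avoiding)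
  have ne: "v \<noteq> x" "v \<noteq> y" "u \<noteq> x" "u \<noteq> y" using assms by (auto dest: no_loops)
  have "q \<in> {u, v} \<union> {x, y}" if "(p, q) \<in> parcs G" "p \<in> {u, v}" for p q
    using that neighbour_cases[of u v x y q] neighbour_cases[of v u x y q] assms ne \<open>x \<noteq> y\<close>
    by (auto intro: arc_sym)
  then have "3 \<le> card {x, y}"
    using z assms
    by (intro k_connected_boundary[OF three_connected, of "{u, v}" _ z])
       (auto dest: in_arcsD1 in_arcsD2)
  then show False using \<open>x \<noteq> y\<close> by simp
qed

text \<open>Contracting \<open>uv\<close> merges two of the three neighbours of \<open>x\<close>,
  which leaves \<open>x\<close> with only two neighbours.\<close>

lemma triangle_not_contractible:
  assumes "(u, v) \<in> parcs G" "(u, x) \<in> parcs G" "(v, x) \<in> parcs G"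
  shows "\<not> three_contractible G {u, v}"
proof
  let ?H = "contract_edge G {u, v}" and ?c = "contract_class {u, v}"
  interpret H: pair_graph ?H by (rule pair_graph_contract_edge)
  assume "three_contractible G {u, v}"
  then have conn: "k_connected 3 ?H" by (simp add: three_contractible_def)
  have ne: "u \<noteq> v" "x \<noteq> u" "x \<noteq> v" using assms by (auto dest: no_loops)
  have "card ({w. (x, w) \<in> parcs G} - {u, v}) = 1"
    using card_neighbours[OF in_arcsD2[OF assms(2)]] ne assms
    by (subst card_Diff_subset) (auto intro: arc_sym)
  then obtain w where w: "{w. (x, w) \<in> parcs G} - {u, v} = {w}" by (auto simp: card_1_singleton_iff)
  then have xw: "(x, w) \<in> parcs G" "w \<noteq> u" "w \<noteq> v" by blast+
  have nx: "y = u \<or> y = v \<or> y = w" if "(x, y) \<in> parcs G" for y using w that by blast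
  obtain z where z: "z \<in> pverts G" "z \<noteq> u" "z \<noteq> v" "z \<noteq> x" "z \<noteq> w" by (rule ex_vert_avoiding)
  have mem: "{y} \<in> pverts ?H" if "y \<in> pverts G" "y \<noteq> u" "y \<noteq> v" for y
    using that by (force simp: contract_edge_def contract_class_def)
  have "{u, v} \<in> pverts ?H"
    using in_arcsD1[OF assms(1)] by (force simp: contract_edge_def contract_class_def)
  moreover have "q \<in> {{x}} \<union> {{u, v}, {w}}" if pq: "(p, q) \<in> parcs ?H" "p \<in> {{x}}" for p q
  proof -
    obtain x' y where "(x', y) \<in> parcs G" "?c x' = {x}" "?c y = q"
      using pq by (auto simp: contract_edge_def)
    then have "(x, y) \<in> parcs G"
      using ne by (auto simp: contract_class_def doubleton_eq_iff split: if_splits)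
    then show ?thesis using nx[of y] \<open>?c y = q\<close> xw(2,3) by (auto simp: contract_class_def)
  qed
  ultimately have "3 \<le> card {{u, v}, {w}}"
    using mem[of x] mem[of w] mem[of z] z ne xw
    by (intro H.k_connected_boundary[OF conn, of "{{x}}" _ "{z}"])
       (auto dest: in_arcsD1 in_arcsD2)
  then show False by (simp add: card_insert_if split: if_splits)
qed

text \<open>Ordered pairs, so that the edges form a relation whose reflexive closure can be treated
  as an equivalence.\<close>

definition noncontractible :: "('a \<times> 'a) set" where
  "noncontractible = {(u, v) \<in> parcs G. \<not> three_contractible G {u, v}}"

lemma noncontractible_sym: "(u, v) \<in> noncontractible \<Longrightarrow> (v, u) \<in> noncontractible"
  by (auto simp: noncontractible_def insert_commute intro: arc_sym)

text \<open>Both separators contain \<open>u\<close> and one of its neighbours. Since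
  \<open>u\<close> has a neighbour on either side and degree 3, its other two neighbours lie on
  different sides. This is the configuration of
  \<open>crossing_separations_triangle\<close>.\<close>

lemma adjacent_noncontractible_triangle:
  assumes "(u, v) \<in> noncontractible" "(u, x) \<in> noncontractible" "x \<noteq> v"
  shows "\<exists>t. (u, t) \<in> parcs G \<and> (v, t) \<in> parcs G"
proof -
  have uv: "(u, v) \<in> parcs G" "(u, x) \<in> parcs G" using assms by (auto simp: noncontractible_def)
  obtain w A B where sep1: "w \<noteq> v" "separation G {u, v, w} A B"
    using assms uv non_contractible_separation[OF three_connected four_less_card, of u v]
    by (auto simp: noncontractible_def)
  obtain w' C D where sep2: "separation G {u, x, w'} C D"
    using assms uv non_contractible_separation[OF three_connected four_less_card, of u x]
    by (auto simp: noncontractible_def)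
  \<comment> \<open>Names the sides of the first separation so that \<open>x\<close> lies in
    \<open>A\<close>.\<close>
  have wlogAB: ?thesis if ab: "separation G {u, v, w} A B" "a \<in> A" "b \<in> B" "(u, a) \<in> parcs G"
    "(u, b) \<in> parcs G" "x = a" for A B a b
  proof -
    have ne: "a \<noteq> v" "b \<noteq> v" "a \<noteq> b" using ab by (auto simp: separation_def)
    have nu: "y \<in> {v, a, b}" if "(u, y) \<in> parcs G" for y
      using neighbour_cases[of u v a b y] uv ab ne that by blast
    \<comment> \<open>Names the sides of the second separation so that \<open>v\<close> lies in
      \<open>C\<close>.\<close>
    have wlogCD: "(a, v) \<in> parcs G" if cd: "separation G {u, x, w'} C D" "v \<in> C" for C D
    proof (rule crossing_separations_triangle[OF three_connected ab(1) cd(1)[unfolded \<open>x = a\<close>]])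
      obtain d where "d \<in> D" "(u, d) \<in> parcs G"
        using three_connected_separation_neighbours(2)[OF three_connected cd(1), of u] by auto
      \<comment> \<open>The neighbour \<open>d\<close> is neither \<open>v\<close>, which is in
        \<open>C\<close>, nor \<open>a\<close>, which is in the separator, so it is
        \<open>b\<close>.\<close>
      then show "b \<in> D" using nu[of d] cd ab(6) by (auto simp: separation_def)
    qed (use uv nu sep1(1) ab cd in auto)
    obtain c where "c \<in> C" "(u, c) \<in> parcs G"
      using three_connected_separation_neighbours(1)[OF three_connected sep2, of u] by auto
    obtain d where "d \<in> D" "(u, d) \<in> parcs G"
      using three_connected_separation_neighbours(2)[OF three_connected sep2, of u] by auto
    \<comment> \<open>The neighbours \<open>c\<close> and \<open>d\<close> of \<open>u\<close> are
      distinct and differ from \<open>a\<close>, so one of them is \<open>v\<close>.\<close>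
    have "v \<in> C \<or> v \<in> D"
      using nu[of c] nu[of d] \<open>c \<in> C\<close> \<open>d \<in> D\<close> \<open>(u, c) \<in> _\<close> \<open>(u, d) \<in> _\<close> sep2 \<open>x = a\<close>
      by (auto simp: separation_def)
    then have "(a, v) \<in> parcs G"
      using wlogCD sep2 separation_commute by blast
    then show ?thesis using ab(4) arc_sym by blast
  qed
  obtain a where a: "a \<in> A" "(u, a) \<in> parcs G"
    using three_connected_separation_neighbours(1)[OF three_connected sep1(2), of u] by auto
  obtain b where b: "b \<in> B" "(u, b) \<in> parcs G"
    using three_connected_separation_neighbours(2)[OF three_connected sep1(2), of u] by auto
  have "a \<noteq> v" "b \<noteq> v" "a \<noteq> b" using a b sep1(2) by (auto simp: separation_def)
  then have "x = a \<or> x = b"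
    using neighbour_cases[of u v a b x] a b uv assms(3) by blast
  then show ?thesis
    using wlogAB[OF sep1(2) a(1) b(1) a(2) b(2)]
      wlogAB[OF sep1(2)[THEN separation_commute[THEN iffD1]] b(1) a(1) b(2) a(2)] by blast
qed

text \<open>Both \<open>pq\<close> and \<open>ps\<close> lie in triangles. Unless
  \<open>t = s\<close>, the neighbours of \<open>p\<close> are \<open>q\<close>, \<open>s\<close>
  and \<open>t\<close>. By uniqueness of the triangle on \<open>pt\<close>, the apex
  \<open>t'\<close> over \<open>ps\<close> is then \<open>q\<close>. Either way \<open>q\<close> and
  \<open>s\<close> are adjacent, and \<open>qs\<close> lies in a triangle with
  \<open>p\<close>.\<close>

lemma noncontractible_trans:
  assumes "(p, q) \<in> noncontractible" "(p, s) \<in> noncontractible" "q \<noteq> s"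
  shows "(q, s) \<in> noncontractible"
proof -
  have arcs: "(p, q) \<in> parcs G" "(p, s) \<in> parcs G" using assms by (auto simp: noncontractible_def)
  obtain t where t: "(p, t) \<in> parcs G" "(q, t) \<in> parcs G"
    using adjacent_noncontractible_triangle[OF assms(1,2)] assms(3) by auto
  obtain t' where t': "(p, t') \<in> parcs G" "(s, t') \<in> parcs G"
    using adjacent_noncontractible_triangle[OF assms(2,1)] assms(3) by auto
  have "(q, s) \<in> parcs G"
  proof (cases "t = s")
    case False
    have "q \<noteq> t" using t by (auto dest: no_loops)
    then have "t' = q \<or> t' = s \<or> t' = t"
      using neighbour_cases[of p q s t t'] arcs t t' False assms(3) by blast
    moreover have "t' \<noteq> s" using t' by (auto dest: no_loops)
    moreover have "t' \<noteq> t"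
      using triangle_unique[of p t q s] arcs t t' assms(3) arc_sym by blast
    ultimately show ?thesis using t' arc_sym by blast
  qed (use t in simp)
  then show ?thesis
    using triangle_not_contractible[of q s p] arcs by (auto simp: noncontractible_def intro: arc_sym)
qed

end

subsection \<open>Counting tree edges\<close>

lemma (in pair_graph) doubleton_in_uedges_iff [simp]: "{u, v} \<in> uedges G \<longleftrightarrow> (u, v) \<in> parcs G"
  by (auto simp: uedges_def doubleton_eq_iff intro: arc_sym)

lemma in_uedgesE:
  assumes "e \<in> uedges G"
  obtains u v where "e = {u, v}" "(u, v) \<in> parcs G"
  using assms by (auto simp: uedges_def)

lemma (in pair_graph) finite_uedges: "finite (uedges G)"
  using pair_finite_arcs by (simp add: uedges_def)

lemma (in pair_graph) induce_verts: "with_proj G \<restriction> pverts G = with_proj G"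
  by (auto simp: induce_subgraph_def with_proj_def dest: in_arcsD1 in_arcsD2)

text \<open>Grows a vertex set \<open>S\<close> one vertex at a time along an edge leaving it. Each
  such edge is new among the edges inside \<open>S\<close>.\<close>

lemma (in pair_graph) connected_card_le_uedges:
  assumes "connected (with_proj G)"
  shows "card (pverts G) \<le> card (uedges G) + 1"
proof -
  have cut: "\<exists>x\<in>X. \<exists>y\<in>pverts G - X. (x, y) \<in> parcs G" if "X \<noteq> {}" "X \<subset> pverts G" for X
    using assms that connected_induce_iff[of "pverts G"] by (simp add: induce_verts)
  have "\<exists>S\<subseteq>pverts G. card S = Suc k \<and> k \<le> card {e \<in> uedges G. e \<subseteq> S}" if "k < card (pverts G)" for k
    using that
  proof (induction k)
    case 0
    then obtain x where "x \<in> pverts G" by fastforce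
    then show ?case by (intro exI[of _ "{x}"]) auto
  next
    case (Suc k)
    then obtain S where S: "S \<subseteq> pverts G" "card S = Suc k" "k \<le> card {e \<in> uedges G. e \<subseteq> S}"
      by auto
    then have "S \<noteq> {}" "S \<subset> pverts G" using Suc.prems by auto
    then obtain x y where xy: "x \<in> S" "y \<in> pverts G" "y \<notin> S" "(x, y) \<in> parcs G"
      using cut by blast
    have fin: "finite S" using S(2) by (simp add: card_ge_0_finite)
    have "Suc k \<le> Suc (card {e \<in> uedges G. e \<subseteq> S})" using S(3) by simp
    also have "\<dots> = card (insert {x, y} {e \<in> uedges G. e \<subseteq> S})"
      using xy finite_uedges by simp
    also have "\<dots> \<le> card {e \<in> uedges G. e \<subseteq> insert y S}"
      using xy finite_uedges by (intro card_mono) auto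
    finally show ?case using S xy fin by (intro exI[of _ "insert y S"]) auto
  qed
  note grow = this
  show ?thesis
  proof (cases "pverts G = {}")
    case False
    then have "card (pverts G) - 1 < card (pverts G)" by (simp add: card_gt_0_iff)
    then obtain S where "card (pverts G) - 1 \<le> card {e \<in> uedges G. e \<subseteq> S}"
      using grow by blast
    also have "\<dots> \<le> card (uedges G)" using finite_uedges by (intro card_mono) auto
    finally show ?thesis by linarith
  qed simp
qed

lemma (in pair_graph) triangle_cycle:
  assumes "(x, y) \<in> parcs G" "(y, z) \<in> parcs G" "(z, x) \<in> parcs G"
  shows "cycle [(x, y), (y, z), (z, x)]"
  using assms by (auto simp: cycle_def awalk_def cas.simps dest: in_arcsD1 no_loops)

text \<open>A forest has at most \<open>card K - 1\<close> edges inside \<open>K\<close>. For sizes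
  1, 2 and 3 this is at most two thirds of \<open>card K\<close>, with equality possible only for
  size 3.\<close>

lemma (in pair_graph) acyclic_card_uedges_le:
  assumes acyclic: "\<not> (\<exists>p. cycle p \<and> 3 \<le> length p)"
    and K: "0 < card K" "card K \<le> 3"
  shows "3 * card {e \<in> uedges G. e \<subseteq> K} \<le> 2 * card K"
proof -
  have edge: "\<exists>u v. e = {u, v} \<and> u \<in> K \<and> v \<in> K \<and> u \<noteq> v"
    if e: "e \<in> uedges G" "e \<subseteq> K" for e
  proof -
    obtain u v where "e = {u, v}" "(u, v) \<in> parcs G" using e(1) by (rule in_uedgesE)
    moreover from this have "u \<noteq> v" by (auto dest: no_loops)
    ultimately show ?thesis using e(2) by (intro exI[of _ u] exI[of _ v]) simp
  qed
  consider "card K = 1" | "card K = 2" | "card K = 3" using K by linarith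
  then show ?thesis
  proof cases
    case 1
    then obtain x where "K = {x}" by (auto simp: card_1_singleton_iff)
    then have none: "{e \<in> uedges G. e \<subseteq> K} = {}" using edge by blast
    show ?thesis unfolding none by simp
  next
    case 2
    then obtain x y where "K = {x, y}" by (auto simp: card_2_iff)
    then have "{e \<in> uedges G. e \<subseteq> K} \<subseteq> {{x, y}}" using edge by blast
    then have "card {e \<in> uedges G. e \<subseteq> K} \<le> card {{x, y}}" by (intro card_mono) auto
    then show ?thesis using 2 by simp
  next
    case 3
    then obtain x y z where K3: "K = {x, y, z}" "x \<noteq> y" "y \<noteq> z" "x \<noteq> z" by (auto simp: card_3_iff)
    have "{e \<in> uedges G. e \<subseteq> K} \<subseteq> {{x, y}, {y, z}, {z, x}}"
    proof
      fix e assume "e \<in> {e \<in> uedges G. e \<subseteq> K}"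
      then obtain u v where "e = {u, v}" "u \<in> K" "v \<in> K" "u \<noteq> v" using edge by blast
      moreover have "u = x \<or> u = y \<or> u = z" "v = x \<or> v = y \<or> v = z"
        using calculation K3(1) by simp_all
      ultimately show "e \<in> {{x, y}, {y, z}, {z, x}}" by (elim disjE) (simp_all add: insert_commute)
    qed
    moreover have "\<not> {{x, y}, {y, z}, {z, x}} \<subseteq> {e \<in> uedges G. e \<subseteq> K}"
      using triangle_cycle[of x y z] acyclic by auto
    ultimately have "{e \<in> uedges G. e \<subseteq> K} \<subset> {{x, y}, {y, z}, {z, x}}"
      by (simp only: less_le_not_le simp_thms)
    then have "card {e \<in> uedges G. e \<subseteq> K} < card {{x, y}, {y, z}, {z, x}}"
      by (intro psubset_card_mono) auto
    also have "\<dots> \<le> 3" by (simp add: card_insert_if)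
    finally show ?thesis using 3 by simp
  qed
qed

section \<open>Lower bound from the classes of the non-contractibility relation\<close>

context cubic_three_connected_graph
begin

text \<open>Adding the identity makes a vertex on no non-contractible edge a class of its own. It
  also absorbs the case of transitivity in which the outer vertices coincide.\<close>

lemma equiv_noncontractible: "equiv (pverts G) (noncontractible \<union> Id_on (pverts G))"
proof (rule equivI)
  show "noncontractible \<union> Id_on (pverts G) \<subseteq> pverts G \<times> pverts G"
    by (auto simp: noncontractible_def dest: in_arcsD1 in_arcsD2)
  show "sym (noncontractible \<union> Id_on (pverts G))"
    by (auto intro!: symI dest: noncontractible_sym)
  show "trans (noncontractible \<union> Id_on (pverts G))"
  proof (rule transI)
    fix p q s
    assume "(p, q) \<in> noncontractible \<union> Id_on (pverts G)" "(q, s) \<in> noncontractible \<union> Id_on (pverts G)"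
    moreover have "p \<in> pverts G" if "(p, q) \<in> noncontractible"
      using that by (auto simp: noncontractible_def dest: in_arcsD1)
    ultimately show "(p, s) \<in> noncontractible \<union> Id_on (pverts G)"
      using noncontractible_trans[of q p s] noncontractible_sym[of p q] by (cases "p = s") auto
  qed
qed (auto simp: refl_on_def)

text \<open>The class of \<open>p\<close> is \<open>p\<close> with its neighbours along
  non-contractible edges. If these were all three neighbours, transitivity would join
  \<open>q\<close> to both \<open>r\<close> and \<open>s\<close> and put the edge \<open>pq\<close>
  into two triangles.\<close>

lemma card_noncontractible_class_le:
  assumes "K \<in> pverts G // (noncontractible \<union> Id_on (pverts G))"
  shows "card K \<le> 3"
proof -
  obtain p where p: "p \<in> pverts G" "K = insert p {q. (p, q) \<in> noncontractible}"
    using assms by (auto simp: quotient_def)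
  let ?N = "{q. (p, q) \<in> noncontractible}"
  have sub: "?N \<subseteq> {q. (p, q) \<in> parcs G}" by (auto simp: noncontractible_def)
  have fin: "finite {q. (p, q) \<in> parcs G}"
    using card_neighbours[OF p(1)] by (intro card_ge_0_finite) simp
  have "?N \<noteq> {q. (p, q) \<in> parcs G}"
  proof
    assume all: "?N = {q. (p, q) \<in> parcs G}"
    obtain q r s where N: "{q. (p, q) \<in> parcs G} = {q, r, s}" and ne: "q \<noteq> r" "r \<noteq> s" "q \<noteq> s"
      using card_neighbours[OF p(1)] by (auto simp: card_3_iff)
    then have "(p, q) \<in> noncontractible" "(p, r) \<in> noncontractible" "(p, s) \<in> noncontractible"
      using all by blast+
    then have "(q, r) \<in> noncontractible" "(q, s) \<in> noncontractible"
      using noncontractible_trans ne by blast+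
    then show False
      using triangle_unique[of p q r s] N ne by (auto simp: noncontractible_def)
  qed
  then have "card ?N < 3"
    using psubset_card_mono[OF fin, of ?N] sub card_neighbours[OF p(1)] by auto
  then show ?thesis using p(2) card_insert_le_m1[of 3 ?N p] by simp
qed

lemma card_contractible_tree_edges:
  assumes Q: "spanning_utree Q G"
  shows "card (pverts G) \<le> 3 * card {e \<in> uedges Q. three_contractible G e} + 3"
proof -
  let ?R = "noncontractible \<union> Id_on (pverts G)"
  let ?F = "{e \<in> uedges Q. \<not> three_contractible G e}"
  interpret Q: pair_graph Q using Q by (simp add: spanning_utree_def)
  have VQ: "pverts Q = pverts G" and EQ: "parcs Q \<subseteq> parcs G"
    using Q by (auto simp: spanning_utree_def spanning_def subgraph_def)
  note acyclic = Q[unfolded spanning_utree_def, THEN conjunct2, THEN conjunct2, THEN conjunct2]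
  have classes: "finite (pverts G // ?R)" 
    using finite_verts equiv_noncontractible by (auto intro: finite_quotient simp: equiv_def)
  have finK: "finite K" "K \<noteq> {}" if "K \<in> pverts G // ?R" for K
    using that in_quotient_imp_non_empty[OF equiv_noncontractible]
      finite_subset[OF in_quotient_imp_subset[OF equiv_noncontractible] finite_verts] by auto
  \<comment> \<open>A non-contractible edge has both ends in one class, so these tree edges can be
    counted class by class.\<close>
  have "?F \<subseteq> (\<Union>K\<in>pverts G // ?R. {e \<in> uedges Q. e \<subseteq> K})"
  proof
    fix e assume e: "e \<in> ?F"
    then obtain u v where uv: "e = {u, v}" "(u, v) \<in> parcs Q" by (auto elim: in_uedgesE)
    then have "(u, v) \<in> noncontractible" "u \<in> pverts G"
      using e EQ by (auto simp: noncontractible_def dest: in_arcsD1)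
    then have "?R `` {u} \<in> pverts G // ?R" "e \<subseteq> ?R `` {u}" using uv by (auto intro: quotientI)
    then show "e \<in> (\<Union>K\<in>pverts G // ?R. {e \<in> uedges Q. e \<subseteq> K})" using e by blast
  qed
  then have "card ?F \<le> card (\<Union>K\<in>pverts G // ?R. {e \<in> uedges Q. e \<subseteq> K})"
    using classes Q.finite_uedges by (intro card_mono) auto
  also have "\<dots> \<le> (\<Sum>K\<in>pverts G // ?R. card {e \<in> uedges Q. e \<subseteq> K})"
    by (rule card_UN_le[OF classes])
  finally have "3 * card ?F \<le> (\<Sum>K\<in>pverts G // ?R. 3 * card {e \<in> uedges Q. e \<subseteq> K})"
    by (simp add: sum_distrib_left[symmetric])
  also have "\<dots> \<le> (\<Sum>K\<in>pverts G // ?R. 2 * card K)"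
    using acyclic finK card_noncontractible_class_le
    by (intro sum_mono Q.acyclic_card_uedges_le) (auto simp: card_gt_0_iff)
  also have "\<dots> = 2 * (\<Sum>K\<in>pverts G // ?R. card K)" by (simp add: sum_distrib_left)
  also have "(\<Sum>K\<in>pverts G // ?R. card K) = card (\<Union>(pverts G // ?R))"
    using finK(1) quotient_disj[OF equiv_noncontractible]
    by (subst card_Union_disjoint) (auto simp: pairwise_def disjnt_def)
  also have "\<Union>(pverts G // ?R) = pverts G" by (rule Union_quotient[OF equiv_noncontractible])
  finally have F: "3 * card ?F \<le> 2 * card (pverts G)" .
  have "uedges Q = {e \<in> uedges Q. three_contractible G e} \<union> ?F" by blast
  then have "card (uedges Q) = card {e \<in> uedges Q. three_contractible G e} + card ?F"
    using Q.finite_uedges by (subst card_Un_disjoint[symmetric]) auto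
  moreover have "card (pverts G) \<le> card (uedges Q) + 1"
    using Q.connected_card_le_uedges Q by (simp add: spanning_utree_def VQ)
  \<comment> \<open>With \<open>c\<close> contractible tree edges, \<open>3 * (|V| - 1) \<le> 3 * c
    + 3 * card ?F \<le> 3 * c + 2 * |V|\<close>.\<close>
  ultimately show ?thesis using F by linarith
qed

end

subsection \<open>Paths as DFS trees\<close>

definition path_graph :: "nat \<Rightarrow> nat pair_pre_digraph" where
  "path_graph n = \<lparr>pverts = {..<n}, parcs = {(i, j). i < n \<and> j < n \<and> (j = Suc i \<or> i = Suc j)}\<rparr>"

lemma pverts_path_graph [simp]: "pverts (path_graph n) = {..<n}"
  by (simp add: path_graph_def)

lemma parcs_path_graph [simp]:
  "(i, j) \<in> parcs (path_graph n) \<longleftrightarrow> i < n \<and> j < n \<and> (j = Suc i \<or> i = Suc j)"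
  by (simp add: path_graph_def)

lemma pair_graph_path_graph: "pair_graph (path_graph n)"
proof
  show "finite (parcs (path_graph n))"
    by (rule finite_subset[of _ "{..<n} \<times> {..<n}"]) auto
  show "symmetric (with_proj (path_graph n))"
    by (auto simp: symmetric_def intro!: symI)
qed auto

interpretation path: pair_graph "path_graph n" for n
  by (rule pair_graph_path_graph)

text \<open>Applied to membership in a vertex set, which is constant along a stretch of consecutive
  vertices if no step changes it.\<close>

lemma eq_on_interval:
  assumes "\<And>k. x \<le> k \<Longrightarrow> k < y \<Longrightarrow> P k \<longleftrightarrow> P (Suc k)" "x \<le> y"
  shows "P x \<longleftrightarrow> P (y :: nat)"
  using assms(2,1) by (induction rule: dec_induct) auto

lemma connected_path_graph:
  assumes "0 < n"
  shows "connected (with_proj (path_graph n))"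
proof -
  have "\<exists>x\<in>X. \<exists>y\<in>{..<n} - X. (x, y) \<in> parcs (path_graph n)" if X: "X \<noteq> {}" "X \<subset> {..<n}" for X
  proof (rule ccontr)
    assume *: "\<not> ?thesis"
    have step: "k \<in> X \<longleftrightarrow> Suc k \<in> X" if "Suc k < n" for k
    proof -
      have "(k, Suc k) \<in> parcs (path_graph n)" "(Suc k, k) \<in> parcs (path_graph n)" "k < n"
        using that by simp_all
      then show ?thesis using * that by blast
    qed
    have "x \<in> X \<longleftrightarrow> y \<in> X" if "x \<le> y" "y < n" for x y
      using that by (intro eq_on_interval[where P = "\<lambda>z. z \<in> X", OF step]) linarith+
    then have "0 \<in> X \<longleftrightarrow> y \<in> X" if "y < n" for y
      using that by blast
    then show False using X by blast
  qed
  then show ?thesis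
    using path.connected_induce_iff[of n "{..<n}"] assms path.induce_verts[of n] by auto
qed

text \<open>A discrete intermediate value theorem: every arc changes the vertex number by exactly
  one.\<close>

lemma path_graph_walk_intermediate:
  assumes "pcas a q b" "set q \<subseteq> parcs (path_graph n)" "a \<le> x \<and> x \<le> b \<or> b \<le> x \<and> x \<le> a"
  shows "x \<in> set (pawalk_verts a q)"
  using assms
proof (induction q arbitrary: a)
  case (Cons e q)
  obtain c where e: "e = (a, c)" using Cons.prems(1) by (cases e) auto
  then have c: "c = Suc a \<or> a = Suc c" "pcas c q b" using Cons.prems by auto
  show ?case
  proof (cases "x = a")
    case False
    then have "x \<in> set (pawalk_verts c q)"
      using Cons.prems c by (intro Cons.IH) auto
    then show ?thesis by (simp add: e)
  qed (simp add: e)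
qed auto

lemma last_in_pawalk_verts: "pcas a q b \<Longrightarrow> b \<in> set (pawalk_verts a q)"
  by (induction q arbitrary: a) auto

text \<open>The first two arcs of a cycle of length at least 3 continue in one direction. The walk
  back to the start must therefore pass the second vertex again.\<close>

lemma path_graph_acyclic:
  assumes cycle: "pre_digraph.cycle (with_proj (path_graph n)) p" and "3 \<le> length p"
  shows False
proof -
  obtain e f g q where p: "p = e # f # g # q"
    using assms(2) by (metis Suc_le_length_iff numeral_3_eq_3)
  obtain u where u: "u \<in> {..<n}" "set p \<subseteq> parcs (path_graph n)" "pcas u p u"
      "distinct (tl (pawalk_verts u p))"
    using cycle by (auto simp: path.cycle_def path.awalk_def)
  obtain v w where e: "e = (u, v)" and f: "f = (v, w)" using u(3) by (cases e; cases f) (auto simp: p)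
  let ?q = "g # q"
  have q: "pcas w ?q u" "set ?q \<subseteq> parcs (path_graph n)" "distinct (v # pawalk_verts w ?q)"
    using u by (auto simp: p e f)
  have "u \<in> set (pawalk_verts (snd g) q)" using q(1) by (intro last_in_pawalk_verts) simp
  moreover have "w \<notin> set (pawalk_verts (snd g) q)" using q(1,3) by simp
  \<comment> \<open>The start \<open>u\<close> recurs as the last vertex, whereas \<open>w\<close>
    does not recur after its own position.\<close>
  ultimately have "w \<noteq> u" by blast
  moreover have "v = Suc u \<or> u = Suc v" "w = Suc v \<or> v = Suc w" using u(2) by (auto simp: p e f)
  ultimately have "u \<le> v \<and> v \<le> w \<or> w \<le> v \<and> v \<le> u" by linarith
  then have "v \<in> set (pawalk_verts w ?q)"
    using q by (intro path_graph_walk_intermediate[of w ?q u n v]) auto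
  then show False using q(3) by simp
qed

text \<open>An interval avoiding \<open>x\<close> survives the deletion. Both directions are
  recorded because branches are strongly connected components.\<close>

lemma path_graph_del_vert_reachable:
  fixes n x :: nat
  defines "D \<equiv> pre_digraph.del_vert (with_proj (path_graph n)) x"
  assumes "a \<le> b" "b < n" "x \<notin> {a..b}"
  shows "a \<rightarrow>\<^sup>*\<^bsub>D\<^esub> b" "b \<rightarrow>\<^sup>*\<^bsub>D\<^esub> a"
proof -
  have D: "verts D = {..<n} - {x}" "arcs_ends D = {(i, j) \<in> parcs (path_graph n). i \<noteq> x \<and> j \<noteq> x}"
    by (auto simp: D_def pre_digraph.del_vert_simps arcs_ends_conv)
  have "a \<rightarrow>\<^sup>*\<^bsub>D\<^esub> b \<and> b \<rightarrow>\<^sup>*\<^bsub>D\<^esub> a"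
    using assms(2-)
  proof (induction rule: dec_induct)
    case base
    then show ?case by (auto simp: reachable_def D)
  next
    case (step k)
    then have IH: "a \<rightarrow>\<^sup>*\<^bsub>D\<^esub> k" "k \<rightarrow>\<^sup>*\<^bsub>D\<^esub> a" by auto
    have k: "Suc k \<in> verts D" "k \<in> verts D" "(k, Suc k) \<in> arcs_ends D" "(Suc k, k) \<in> arcs_ends D"
      using step.hyps step.prems by (auto simp: D)
    show ?case
      using IH k unfolding reachable_def
      by (blast intro: rtrancl_on_into_rtrancl_on converse_rtrancl_on_into_rtrancl_on)
  qed
  then show "a \<rightarrow>\<^sup>*\<^bsub>D\<^esub> b" "b \<rightarrow>\<^sup>*\<^bsub>D\<^esub> a" by auto
qed

text \<open>Vertices below \<open>x\<close> stay connected to the root 0, so a branch lies entirely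
  above \<open>x\<close>. All vertices above \<open>x\<close> reach one another, hence form a single
  component.\<close>

lemma branches_path_graph_unique:
  assumes "0 < n" "B \<in> branches (path_graph n) 0 x" "C \<in> branches (path_graph n) 0 x"
  shows "B = C"
proof -
  let ?D = "pre_digraph.del_vert (with_proj (path_graph n)) x"
  have scc: "B' \<noteq> {}" "0 \<notin> B'" "\<And>u v. u \<in> B' \<Longrightarrow> v \<in> B' \<Longrightarrow> u \<rightarrow>\<^sup>*\<^bsub>?D\<^esub> v"
    "\<And>u v. u \<in> B' \<Longrightarrow> u \<rightarrow>\<^sup>*\<^bsub>?D\<^esub> v \<Longrightarrow> v \<rightarrow>\<^sup>*\<^bsub>?D\<^esub> u \<Longrightarrow> v \<in> B'"
    if "B' \<in> branches (path_graph n) 0 x" for B'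
    using that by (auto simp: branches_def pre_digraph.sccs_verts_def)
  have above: "x < b \<and> b < n" if B': "B' \<in> branches (path_graph n) 0 x" "b \<in> B'" for B' b
  proof -
    have "b \<rightarrow>\<^sup>*\<^bsub>?D\<^esub> b" using scc(3) B' by blast
    then have "b \<in> verts ?D" unfolding reachable_def by (rule in_rtrancl_on_in_F)
    then have b: "b < n" "b \<noteq> x" by (auto simp: pre_digraph.del_vert_simps)
    moreover have "\<not> b < x"
    proof
      assume "b < x"
      then have "b \<rightarrow>\<^sup>*\<^bsub>?D\<^esub> 0" "0 \<rightarrow>\<^sup>*\<^bsub>?D\<^esub> b"
        using path_graph_del_vert_reachable[of 0 b n x] b by auto
      then show False using scc(2,4) B' by blast
    qed
    ultimately show ?thesis by linarith
  qed
  have sub: "B' \<subseteq> C'" if BC: "B' \<in> branches (path_graph n) 0 x" "C' \<in> branches (path_graph n) 0 x"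
    for B' C'
  proof
    fix b assume "b \<in> B'"
    obtain c where "c \<in> C'" using scc(1) BC(2) by blast
    have "c \<rightarrow>\<^sup>*\<^bsub>?D\<^esub> b \<and> b \<rightarrow>\<^sup>*\<^bsub>?D\<^esub> c"
      using path_graph_del_vert_reachable[of b c n x] path_graph_del_vert_reachable[of c b n x]
        above[OF BC(1) \<open>b \<in> B'\<close>] above[OF BC(2) \<open>c \<in> C'\<close>] by (cases "b \<le> c") auto
    then show "b \<in> C'" using scc(4) BC(2) \<open>c \<in> C'\<close> by blast
  qed
  show ?thesis using sub assms by blast
qed

text \<open>The path is rooted at an end, so no vertex has two branches.\<close>

lemma dfs_tree_path_graph:
  assumes "pair_graph G" "pverts G = {..<n}" "0 < n" "parcs (path_graph n) \<subseteq> parcs G"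
  shows "dfs_tree (path_graph n) G 0"
proof -
  interpret pair_graph G by fact
  have "spanning (with_proj (path_graph n)) (with_proj G)"
    using assms path.wf_digraph wf_digraph by (auto simp: spanning_def subgraph_def)
  then show ?thesis
    using branches_path_graph_unique[OF assms(3)] connected_path_graph[OF assms(3)]
      path_graph_acyclic assms pair_graph_path_graph
    unfolding dfs_tree_def spanning_utree_def by blast
qed

subsection \<open>Truncated Moebius ladders\<close>

text \<open>
  The Moebius ladder on \<open>2p\<close> vertices with every vertex replaced by a triangle, numbered along a
  Hamiltonian cycle that passes through the triangles \<open>{3k, 3k + 1, 3k + 2}\<close> consecutively.
\<close>

definition ladder_adj :: "nat \<Rightarrow> nat \<Rightarrow> nat \<Rightarrow> bool" where
  "ladder_adj p i j \<longleftrightarrow> i < 6 * p \<and> j < 6 * p \<and>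
     (j = Suc i \<or> i = Suc j \<or> i = 0 \<and> Suc j = 6 * p \<or> j = 0 \<and> Suc i = 6 * p \<or>
      i mod 3 = 0 \<and> j = i + 2 \<or> j mod 3 = 0 \<and> i = j + 2 \<or>
      i mod 3 = 1 \<and> (j = i + 3 * p \<or> i = j + 3 * p))"

definition truncated_ladder :: "nat \<Rightarrow> nat pair_pre_digraph" where
  "truncated_ladder p = \<lparr>pverts = {..<6 * p}, parcs = {(i, j). ladder_adj p i j}\<rparr>"

lemma pverts_truncated_ladder [simp]: "pverts (truncated_ladder p) = {..<6 * p}"
  by (simp add: truncated_ladder_def)

lemma parcs_truncated_ladder [simp]: "(i, j) \<in> parcs (truncated_ladder p) \<longleftrightarrow> ladder_adj p i j"
  by (simp add: truncated_ladder_def)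

lemma ladder_adj_sym: "ladder_adj p i j \<Longrightarrow> ladder_adj p j i"
  unfolding ladder_adj_def by auto

lemma ladder_adj_irrefl: "\<not> ladder_adj p i i"
  unfolding ladder_adj_def by presburger

lemma pair_graph_truncated_ladder: "pair_graph (truncated_ladder p)"
proof
  show "finite (parcs (truncated_ladder p))"
    by (rule finite_subset[of _ "{..<6 * p} \<times> {..<6 * p}"]) (auto simp: ladder_adj_def)
  show "symmetric (with_proj (truncated_ladder p))"
    by (auto simp: symmetric_def intro!: symI ladder_adj_sym)
qed (auto simp: ladder_adj_irrefl, auto simp: ladder_adj_def)

text \<open>In the triangle \<open>{3k, 3k + 1, 3k + 2}\<close> the first vertex has its outside
  neighbour just before it on the cycle, the last one just after it. The middle vertex carries the
  rung, which leads to the opposite point of the cycle at distance \<open>3 * p\<close>.\<close>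

lemma cubic_truncated_ladder:
  assumes "0 < p"
  shows "cubic (truncated_ladder p)"
  unfolding cubic_def
proof
  fix v assume "v \<in> pverts (truncated_ladder p)"
  then have v: "v < 6 * p" by simp
  have "out_arcs (with_proj (truncated_ladder p)) v = Pair v ` {w. ladder_adj p v w}"
    by (auto simp: out_arcs_def)
  then have deg: "out_degree (with_proj (truncated_ladder p)) v = card {w. ladder_adj p v w}"
    by (simp add: out_degree_def card_image inj_on_def)
  consider "v mod 3 = 0" | "v mod 3 = 1" | "v mod 3 = 2" by linarith
  then show "out_degree (with_proj (truncated_ladder p)) v = 3"
  proof cases
    case 1
    have "ladder_adj p v w \<longleftrightarrow> w = v + 1 \<or> w = v + 2 \<or> w = (if v = 0 then 6 * p - 1 else v - 1)" for w
    proof -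
      have "v + 2 < 6 * p" "\<not> (3 dvd w \<and> v = w + 2)" using 1 v by presburger+
      then show ?thesis using 1 v unfolding ladder_adj_def by auto
    qed
    then have "{w. ladder_adj p v w} = {v + 1, v + 2, if v = 0 then 6 * p - 1 else v - 1}" by auto
    then show ?thesis using assms unfolding deg by simp
  next
    case 2
    have "ladder_adj p v w \<longleftrightarrow> w = v + 1 \<or> w = v - 1 \<or> w = (if v < 3 * p then v + 3 * p else v - 3 * p)" for w
    proof -
      have "0 < v" "Suc v < 6 * p" "\<not> (3 dvd w \<and> v = w + 2)" using 2 v by presburger+
      then show ?thesis using 2 v unfolding ladder_adj_def by auto
    qed
    then have "{w. ladder_adj p v w} = {v + 1, v - 1, if v < 3 * p then v + 3 * p else v - 3 * p}" by auto
    moreover have "0 < v" using 2 by (cases v) auto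
    then have "v - 1 \<noteq> (if v < 3 * p then v + 3 * p else v - 3 * p)"
      "v + 1 \<noteq> (if v < 3 * p then v + 3 * p else v - 3 * p)"
      using assms by (cases "v < 3 * p"; simp; linarith)+
    ultimately show ?thesis unfolding deg by simp
  next
    case 3
    then obtain u where u: "v = u + 2" "3 dvd u" by (metis add.commute dvd_minus_mod le_add_diff_inverse mod_less_eq_dividend)
    have "ladder_adj p v w \<longleftrightarrow> w = u + 1 \<or> w = u \<or> w = (if v = 6 * p - 1 then 0 else v + 1)" for w
      using 3 v u unfolding ladder_adj_def by auto
    then have "{w. ladder_adj p v w} = {u + 1, u, if v = 6 * p - 1 then 0 else v + 1}" by auto
    moreover have "u \<noteq> 0" if "v = 6 * p - 1" using that u(1) assms by presburger
    ultimately show ?thesis using u unfolding deg by auto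
  qed
qed

text \<open>Deleting \<open>i\<close> and \<open>j\<close> splits the Hamiltonian cycle into an
  inner and an outer stretch, both nonempty because of \<open>a\<close> and \<open>b\<close>. A rung
  with an end in the shorter stretch leads to the other one. If there is none, the shorter stretch
  contains no middle vertex of a triangle, and an edge \<open>{3k, 3k + 2}\<close> joins the
  stretches.\<close>

lemma ladder_crossing_chord:
  assumes "i < j" "j < 6 * p" "i < a" "a < j" "b < i \<or> j < b" "b < 6 * p"
  shows "\<exists>x y. i < x \<and> x < j \<and> (y < i \<or> j < y \<and> y < 6 * p) \<and> ladder_adj p x y"
proof (rule ccontr)
  assume none: "\<not> ?thesis"
  have no: "\<not> ladder_adj p x y" if "i < x" "x < j" "y < i \<or> j < y \<and> y < 6 * p" for x y
    using none that by blast
  show False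
  proof (cases "j \<le> i + 3 * p")
    case True
    have mid: "x mod 3 \<noteq> 1" if x: "i < x" "x < j" for x
    proof
      assume "x mod 3 = 1"
      moreover define y where "y = (if x < 3 * p then x + 3 * p else x - 3 * p)"
      ultimately have "ladder_adj p x y" using x assms(2) by (auto simp: ladder_adj_def)
      moreover have "y < i \<or> j < y \<and> y < 6 * p" using x True assms(2) by (auto simp: y_def)
      ultimately show False using no[OF x] by blast
    qed
    \<comment> \<open>Residue 2 means that \<open>i\<close> is the middle of a triangle, whose long
      edge jumps over \<open>i\<close>. Residue 0 makes \<open>i + 2\<close> a middle vertex, so it
      must be \<open>j\<close>, and the long edge jumps over \<open>j\<close>.\<close>
    consider "(i + 1) mod 3 = 2" | "(i + 1) mod 3 = 0"
      using mid[of "i + 1"] assms by linarith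
    then show False
    proof cases
      case 1
      then have "0 < i" "(i - 1) mod 3 = 0" by presburger+
      then show False
        using no[of "i + 1" "i - 1"] assms by (auto simp: ladder_adj_def)
    next
      case 2
      then have "(i + 2) mod 3 = 1" "i + 3 \<noteq> 6 * p" by presburger+
      moreover from this have "i + 3 < 6 * p" using assms by linarith
      moreover from calculation have "j = i + 2" using mid[of "i + 2"] assms by force
      ultimately show False
        using no[of "i + 1" "i + 3"] 2 assms by (auto simp: ladder_adj_def)
    qed
  next
    case False
    \<comment> \<open>Now the outer stretch is the shorter one, and a rung starting in it ends
      inside.\<close>
    have out: "y mod 3 \<noteq> 1" if y: "y < i \<or> j < y" "y < 6 * p" for y
    proof
      assume "y mod 3 = 1"
      moreover define x where "x = (if y < 3 * p then y + 3 * p else y - 3 * p)"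
      ultimately have "ladder_adj p y x" using y(2) by (auto simp: ladder_adj_def)
      moreover have "i < x" "x < j" using y False assms(1,2) by (auto simp: x_def split: if_splits)
      ultimately show False using no[of x y] y ladder_adj_sym by blast
    qed
    show False
    proof (cases "Suc j < 6 * p")
      case True
      have "(j + 1) mod 3 \<noteq> 1" using out[of "j + 1"] True by simp
      then consider "(j + 1) mod 3 = 2" | "(j + 1) mod 3 = 0" by linarith
      then show False
      proof cases
        case 1
        then have "(j - 1) mod 3 = 0" by presburger
        moreover have "0 < p" using assms(2) by (cases p) auto
        then have "i < j - 1" using False by linarith
        ultimately show False
          using no[of "j - 1" "j + 1"] True assms False by (auto simp: ladder_adj_def)
      next
        case 2
        then have "(j + 2) mod 3 = 1" "j + 2 < 6 * p" using True by presburger+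
        then show False using out[of "j + 2"] by simp
      qed
    next
      case last: False
      \<comment> \<open>Here \<open>j\<close> is the last vertex, so \<open>b\<close> lies below
        \<open>i\<close>. As the middle vertex 1 does not, the outer stretch is just 0, and the edge
        from 0 to 2 crosses.\<close>
      then have "i = 1" using out[of 1] assms by force
      then show False
        using no[of 2 0] assms False by (auto simp: ladder_adj_def)
    qed
  qed
qed

text \<open>At most two deleted vertices leave at most two stretches of the Hamiltonian cycle.
  Membership in \<open>A\<close> is constant on each stretch, and a crossing edge makes it agree on
  both, contrary to \<open>A\<close> and \<open>B\<close> being nonempty.\<close>

lemma three_connected_truncated_ladder:
  assumes "0 < p"
  shows "k_connected 3 (truncated_ladder p)"
proof -
  interpret pair_graph "truncated_ladder p" by (rule pair_graph_truncated_ladder)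
  have False if sep: "separation (truncated_ladder p) T A B" and "card T < 3" for T A B
  proof -
    let ?P = "\<lambda>x. x \<in> A"
    have V: "T \<union> A \<union> B = {..<6 * p}" and disj: "A \<inter> B = {}" "T \<inter> A = {}" "T \<inter> B = {}"
      and "A \<noteq> {}" "B \<noteq> {}"
      using sep by (auto simp: separation_def)
    have adj: "?P x \<longleftrightarrow> ?P y" if xy: "ladder_adj p x y" "x \<notin> T" "y \<notin> T" for x y
    proof -
      have "x \<in> A \<union> B" "y \<in> A \<union> B" using xy V by (auto simp: ladder_adj_def)
      moreover have "\<not> (x \<in> A \<and> y \<in> B)" "\<not> (y \<in> A \<and> x \<in> B)"
        using sep xy(1) ladder_adj_sym[OF xy(1)] by (auto simp: separation_def)
      ultimately show ?thesis using disj by blast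
    qed
    have path: "?P x \<longleftrightarrow> ?P y" if "x \<le> y" "y < 6 * p" "{x..y} \<inter> T = {}" for x y
    proof (rule eq_on_interval[where P = ?P])
      fix k assume "x \<le> k" "k < y"
      moreover from this have "k \<in> {x..y}" "Suc k \<in> {x..y}" by auto
      then have "k \<notin> T" "Suc k \<notin> T" using that(3) by blast+
      ultimately show "?P k \<longleftrightarrow> ?P (Suc k)"
        using that by (intro adj) (auto simp: ladder_adj_def)
    qed (rule that(1))
    obtain a b where ab: "a \<in> A" "b \<in> B" using \<open>A \<noteq> {}\<close> \<open>B \<noteq> {}\<close> by blast
    then have ab': "a < 6 * p" "b < 6 * p" "a \<notin> T" "b \<notin> T" "b \<notin> A" using V disj by auto
    have "T \<noteq> {}"
    proof
      assume "T = {}"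
      then have "?P 0 \<longleftrightarrow> ?P a" "?P 0 \<longleftrightarrow> ?P b" using path ab' by auto
      then show False using ab ab' by blast
    qed
    then have "card T = 1 \<or> card T = 2"
      using \<open>card T < 3\<close> V finite_subset[of T "{..<6 * p}"] card_gt_0_iff[of T] by force
    \<comment> \<open>A single separating vertex is represented by \<open>i = j\<close>, with an
      empty inner stretch.\<close>
    then obtain i j where ij: "T = {i, j}" "i \<le> j"
    proof
      assume "card T = 1"
      then show ?thesis using that by (auto simp: card_1_singleton_iff)
    next
      assume "card T = 2"
      then obtain i j where "T = {i, j}" by (auto simp: card_2_iff)
      then show ?thesis using that[of i j] that[of j i] by (cases "i \<le> j") auto
    qed
    then have j: "j < 6 * p" using V by auto
    have inner: "?P x \<longleftrightarrow> ?P y" if "i < x" "x \<le> y" "y < j" for x y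
      using that j ij by (intro path) auto
    have outer: "?P x \<longleftrightarrow> ?P y"
      if "x \<le> y" "y < 6 * p" "x < i \<or> j < x" "y < i \<or> j < y" for x y
    proof (cases "x < i \<and> j < y")
      \<comment> \<open>The outer stretch wraps around through the edge between
        \<open>6 * p - 1\<close> and 0.\<close>
      case True
      have "?P 0 \<longleftrightarrow> ?P x" using True that ij by (intro path) auto
      moreover have "?P y \<longleftrightarrow> ?P (6 * p - 1)" using True that ij by (intro path) auto
      moreover have "?P 0 \<longleftrightarrow> ?P (6 * p - 1)"
        using True that ij assms by (intro adj) (auto simp: ladder_adj_def)
      ultimately show ?thesis by blast
    next
      case False
      then show ?thesis using that ij by (intro path) auto
    qed
    have inner': "?P x \<longleftrightarrow> ?P y" if "i < x" "x < j" "i < y" "y < j" for x y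
      using that inner[of x y] inner[of y x] nat_le_linear[of x y] by blast
    have outer': "?P x \<longleftrightarrow> ?P y"
      if "x < 6 * p" "y < 6 * p" "x < i \<or> j < x" "y < i \<or> j < y" for x y
      using that outer[of x y] outer[of y x] nat_le_linear[of x y] by blast
    have cross: False if in_out: "i < c" "c < j" "d < i \<or> j < d" "d < 6 * p" "?P c \<noteq> ?P d" for c d
    proof -
      obtain x y where xy: "i < x" "x < j" "y < i \<or> j < y \<and> y < 6 * p" "ladder_adj p x y"
        using ladder_crossing_chord[of i j p c d] in_out j by auto
      then have "?P x \<longleftrightarrow> ?P y" using ij by (intro adj) auto
      moreover have "?P c \<longleftrightarrow> ?P x" using in_out xy by (intro inner') auto
      moreover have "?P d \<longleftrightarrow> ?P y" using in_out xy j ij by (intro outer') auto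
      ultimately show False using in_out(5) by blast
    qed
    have "a \<noteq> i" "a \<noteq> j" "b \<noteq> i" "b \<noteq> j" using ab' ij by auto
    then consider "i < a \<and> a < j" "i < b \<and> b < j" | "i < a \<and> a < j" "b < i \<or> j < b"
      | "a < i \<or> j < a" "i < b \<and> b < j" | "a < i \<or> j < a" "b < i \<or> j < b"
      by linarith
    then show False
      using cross[of a b] cross[of b a] inner'[of a b] outer'[of a b] ab ab' by cases blast+
  qed
  then show ?thesis using assms by (auto simp: k_connected_iff_separation not_less[symmetric])
qed

text \<open>Only the \<open>2 * p - 1\<close> path edges between consecutive triangles can be
  contractible, as the others lie in triangles. The general lower bound has the same value, so their
  contractibility follows from the count without a direct check.\<close>

lemma truncated_ladder_contractible_path_edges:
  assumes "0 < p"
  shows "card {e \<in> uedges (path_graph (6 * p)). three_contractible (truncated_ladder p) e} = 2 * p - 1"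
proof -
  let ?G = "truncated_ladder p" and ?Q = "path_graph (6 * p)"
  let ?C = "{e \<in> uedges ?Q. three_contractible ?G e}"
  have pg: "pair_graph ?G" by (rule pair_graph_truncated_ladder)
  have sub: "parcs ?Q \<subseteq> parcs ?G" by (auto simp: ladder_adj_def)
  have not_K4: "\<not> K\<^bsub>4\<^esub> (with_proj ?G)"
    using assms by (auto simp: complete_digraph_pair_def)
  interpret cubic_three_connected_graph ?G
    using pg assms not_K4 cubic_truncated_ladder three_connected_truncated_ladder
    by (simp add: cubic_three_connected_graph_def cubic_three_connected_graph_axioms_def)
  have "spanning_utree ?Q ?G"
    using dfs_tree_path_graph[OF pg _ _ sub] assms by (simp add: dfs_tree_def)
  then have ge: "2 * p - 1 \<le> card ?C"
    using card_contractible_tree_edges by fastforce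
  have "?C \<subseteq> (\<lambda>k. {3 * k + 2, 3 * k + 3}) ` {..<2 * p - 1}"
  proof
    fix e assume e: "e \<in> ?C"
    then obtain i where i: "e = {i, Suc i}" "Suc i < 6 * p"
      by (auto simp: insert_commute elim!: in_uedgesE)
    have "i mod 3 = 2"
    proof (rule ccontr)
      assume "i mod 3 \<noteq> 2"
      then consider "i mod 3 = 0" | "i mod 3 = 1" by linarith
      \<comment> \<open>The witness is the third vertex of the triangle containing \<open>i\<close>
        and \<open>Suc i\<close>.\<close>
      then have "\<exists>x. ladder_adj p i x \<and> ladder_adj p (Suc i) x"
      proof cases
        case 1
        then have "i + 2 < 6 * p" using i(2) by presburger
        then show ?thesis using 1 by (intro exI[of _ "i + 2"]) (auto simp: ladder_adj_def)
      next
        case 2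
        then have "0 < i" "(i - 1) mod 3 = 0" by presburger+
        then show ?thesis using i(2) by (intro exI[of _ "i - 1"]) (auto simp: ladder_adj_def)
      qed
      moreover have "ladder_adj p i (Suc i)" using i(2) by (simp add: ladder_adj_def)
      ultimately have "\<not> three_contractible ?G e"
        using triangle_not_contractible[of i "Suc i"] i(1) by auto
      then show False using e by simp
    qed
    then have "i = 3 * (i div 3) + 2" using mult_div_mod_eq[of 3 i] by linarith
    \<comment> \<open>The last triangle has no successor on the path:
      \<open>3 * k + 3 < 6 * p\<close> means \<open>k < 2 * p - 1\<close>.\<close>
    moreover from this have "Suc i = 3 * (i div 3) + 3" "i div 3 < 2 * p - 1"
      using i(2) by linarith+
    ultimately show "e \<in> (\<lambda>k. {3 * k + 2, 3 * k + 3}) ` {..<2 * p - 1}"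
      using i(1) by (intro image_eqI[of _ _ "i div 3"]) auto
  qed
  then have "card ?C \<le> card ((\<lambda>k. {3 * k + 2, 3 * k + 3}) ` {..<2 * p - 1})"
    by (intro card_mono) auto
  also have "\<dots> \<le> 2 * p - 1" using card_image_le[of "{..<2 * p - 1}"] by simp
  finally show ?thesis using ge by simp
qed

theorem theorem4:
  shows "(\<forall>G :: 'a pair_pre_digraph.
            pair_graph G \<and> cubic G \<and> k_connected 3 G \<and> \<not> K\<^bsub>4\<^esub> (with_proj G) \<longrightarrow>
            (\<forall>Q. spanning_utree Q G \<longrightarrow>
               real (card {e \<in> uedges Q. three_contractible G e}) \<ge> real (card (pverts G)) / 3 - 1))
       \<and> (\<forall>N. \<exists>G :: nat pair_pre_digraph.
            N < card (pverts G) \<and>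
            pair_graph G \<and> cubic G \<and> k_connected 3 G \<and> \<not> K\<^bsub>4\<^esub> (with_proj G) \<and>
            (\<exists>Q r. dfs_tree Q G r \<and>
               real (card {e \<in> uedges Q. three_contractible G e}) = real (card (pverts G)) / 3 - 1))"
proof (intro conjI allI impI)
  fix G Q :: "'a pair_pre_digraph"
  assume "pair_graph G \<and> cubic G \<and> k_connected 3 G \<and> \<not> K\<^bsub>4\<^esub> (with_proj G)"
  then interpret cubic_three_connected_graph G
    by (simp add: cubic_three_connected_graph_def cubic_three_connected_graph_axioms_def)
  assume "spanning_utree Q G"
  from card_contractible_tree_edges[OF this]
  show "real (card {e \<in> uedges Q. three_contractible G e}) \<ge> real (card (pverts G)) / 3 - 1"
    by linarith
next
  fix N :: nat
  \<comment> \<open>The parameter \<open>Suc N\<close> is positive and gives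
    \<open>6 * Suc N > N\<close> vertices, so sharp examples of any size are obtained.\<close>
  let ?G = "truncated_ladder (Suc N)" and ?Q = "path_graph (6 * Suc N)"
  have "parcs ?Q \<subseteq> parcs ?G" by (auto simp: ladder_adj_def)
  then have "dfs_tree ?Q ?G 0"
    by (intro dfs_tree_path_graph pair_graph_truncated_ladder) auto
  moreover have "real (card {e \<in> uedges ?Q. three_contractible ?G e}) = real (card (pverts ?G)) / 3 - 1"
    by (subst truncated_ladder_contractible_path_edges) auto
  moreover have "\<not> K\<^bsub>4\<^esub> (with_proj ?G)" by (auto simp: complete_digraph_pair_def)
  ultimately show "\<exists>G :: nat pair_pre_digraph.
            N < card (pverts G) \<and>
            pair_graph G \<and> cubic G \<and> k_connected 3 G \<and> \<not> K\<^bsub>4\<^esub> (with_proj G) \<and>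
            (\<exists>Q r. dfs_tree Q G r \<and>
               real (card {e \<in> uedges Q. three_contractible G e}) = real (card (pverts G)) / 3 - 1)"
    using cubic_truncated_ladder three_connected_truncated_ladder pair_graph_truncated_ladder
    by (intro exI[of _ ?G] conjI exI[of _ ?Q] exI[of _ 0]) auto
qed

end
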